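(* For integers $m\geq 2$, let $q_m(n)=0$ if $p^m\mid n$ for some prime $p$, and $q_m(n)=1$ otherwise. Then for every $m\geq 2$ and every $k\geq 2$ the sequence $(q_m(n))_{n\geq 1}$ is not $k$-automatic; hence for each $m\geq 2$ the series $\sum_{n\geq 1}q_m(n)X^n$ is transcendental over $\mathbb{F}_p(X)$ for every prime $p$ and over $\mathbb{Z}(X)$.
   Context: A sequence $(t(n))_{n\geq 1}$ taking values in a finite set is $k$-automatic (for an integer $k\geq 2$) if its $k$-kernel $\{(t(k^l n+r))_{n}: l\geq 0,\ 0\leq r<k^l\}$ is finite. *)

theory Defs
  imports
    "HOL-Library.FuncSet"
    "HOL-Computational_Algebra.Polynomial_FPS"
    "HOL-Computational_Algebra.Polynomial_Factorial"
    "HOL-Algebra.Finite_Extensions"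
    "HOL-Algebra.Algebraic_Closure_Type"
    "Berlekamp_Zassenhaus.Finite_Field"
begin

text \<open>
  Sequences are indexed by the positive integers, so a sequence is a function on \<^typ>\<open>nat\<close>
  whose value at 0 is irrelevant; kernel elements are accordingly restricted to \<open>{1..}\<close>.
\<close>

definition kernel_seqs :: "nat \<Rightarrow> (nat \<Rightarrow> 'a) \<Rightarrow> (nat \<Rightarrow> 'a) set" where
  "kernel_seqs k t = {(\<lambda>n\<in>{1..}. t (k ^ l * n + r)) | l r. r < k ^ l}"

definition automatic :: "nat \<Rightarrow> (nat \<Rightarrow> 'a) \<Rightarrow> bool" where
  "automatic k t \<longleftrightarrow> finite (t ` {1..}) \<and> finite (kernel_seqs k t)"

definition qfree :: "nat \<Rightarrow> nat \<Rightarrow> nat" where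
  "qfree m n = (if \<exists>p. prime p \<and> p ^ m dvd n then 0 else 1)"

definition qfree_series :: "nat \<Rightarrow> 'a::comm_ring_1 fps" where
  "qfree_series m = Abs_fps (\<lambda>n. if n \<ge> 1 then of_nat (qfree m n) else 0)"

text \<open>
  For an integral domain \<open>R\<close>, the field \<open>R(X)\<close> of fractions of \<open>R[X]\<close>, viewed inside the field
  of fractions of \<open>R[[X]]\<close>. For \<open>R\<close> the integers this is what is written \<open>\<int>(X)\<close>
  (which coincides with \<open>\<rat>(X)\<close>).
\<close>

definition rational_functions :: "'a::idom fps fract set" where
  "rational_functions =
     {to_fract (fps_of_poly a) / to_fract (fps_of_poly b) | a b. b \<noteq> 0}"

definition transcendental_series :: "'a::idom fps \<Rightarrow> bool" where
  "transcendental_series f \<longleftrightarrow>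
     (ring.transcendental (ring_of_type_algebra :: 'a fps fract ring) over rational_functions)
       (to_fract f)"

lemma subfield_rational_functions:
  "subfield (rational_functions :: 'a::idom fps fract set) ring_of_type_algebra"
proof -
  let ?R = "ring_of_type_algebra :: 'a fps fract ring"
  let ?i = "\<lambda>p::'a poly. to_fract (fps_of_poly p)"
  interpret field ?R by (rule field_from_type_algebra)
  have i: "?i (a + b) = ?i a + ?i b" "?i (a * b) = ?i a * ?i b" "?i (- a) = - ?i a"
    "?i 0 = 0" "?i 1 = 1" "?i a = 0 \<longleftrightarrow> a = 0" for a b
    by (simp_all add: fps_of_poly_add fps_of_poly_mult fps_of_poly_uminus)
  have mem: "x \<in> rational_functions \<longleftrightarrow> (\<exists>a b. x = ?i a / ?i b \<and> b \<noteq> 0)" for x :: "'a fps fract"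
    by (auto simp: rational_functions_def)
  have one: "1 \<in> (rational_functions :: 'a fps fract set)"
    unfolding mem by (intro exI[of _ 1]) (simp add: i)
  have add: "x + y \<in> rational_functions" and mult: "x * y \<in> rational_functions"
    if xy: "x \<in> rational_functions" "y \<in> rational_functions" for x y :: "'a fps fract"
  proof -
    obtain a b c d where x: "x = ?i a / ?i b" "b \<noteq> 0" and y: "y = ?i c / ?i d" "d \<noteq> 0"
      using xy unfolding mem by blast
    have "x + y = ?i (a * d + c * b) / ?i (b * d)" "x * y = ?i (a * c) / ?i (b * d)"
      using x y by (simp_all add: i add_frac_eq del: to_fract_add to_fract_mult)
    moreover have "b * d \<noteq> 0" using x y by simp
    ultimately show "x + y \<in> rational_functions" "x * y \<in> rational_functions"
      unfolding mem by blast+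
  qed
  have neg: "- x \<in> rational_functions" if "x \<in> rational_functions" for x :: "'a fps fract"
    using that unfolding mem by (metis i(3) minus_divide_left)
  have inv: "inverse x \<in> rational_functions" if "x \<in> rational_functions" "x \<noteq> 0"
    for x :: "'a fps fract"
    using that unfolding mem by (metis i(4) inverse_divide div_0)
  have a_inv: "\<ominus>\<^bsub>?R\<^esub> x = - x" for x
    by (rule minus_equality) (auto simp: ring_of_type_algebra_def)
  have m_inv: "inv\<^bsub>?R\<^esub> x = inverse x" if "x \<noteq> 0" for x
    using that by (intro comm_inv_char) (auto simp: ring_of_type_algebra_def)
  show ?thesis
  proof (rule subfieldI')
    show "subring rational_functions ?R"
      by (rule subringI)
        (use one add mult neg a_inv in \<open>auto simp: ring_of_type_algebra_def\<close>)
    show "inv\<^bsub>?R\<^esub> x \<in> rational_functions" if "x \<in> rational_functions - {\<zero>\<^bsub>?R\<^esub>}" for x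
      using that m_inv inv by (auto simp: ring_of_type_algebra_def)
  qed
qed

end

theory Submission
  imports Defs
begin

text \<open>
  The kernel sequences \<open>q\<^sub>m(k\<^sup>l n + 1)\<close>, \<open>l \<ge> 1\<close>, are pairwise distinct: for \<open>l < l'\<close> and a
  prime \<open>p > k\<^bsup>l'\<^esup>\<close>, restricting \<open>n\<close> to the residue class modulo \<open>p\<^sup>m\<close> on which \<open>p\<^sup>m\<close> divides
  \<open>k\<^sup>l n + 1\<close> makes \<open>k\<^bsup>l'\<^esup> n + 1\<close> run through an arithmetic progression with coprime parameters.
  Such a progression contains a squarefree number, because \<open>\<Sum>1/d\<^sup>2\<close> over \<open>d \<ge> 2\<close> is less than 1.

  In characteristic \<open>p\<close> transcendence follows from one direction of Christol's theorem: if \<open>f\<close> is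
  algebraic, its iterated \<open>p\<close>-th powers satisfy a linear relation with polynomial coefficients,
  the coefficient of \<open>f\<close> itself may be taken nonzero, and this relation confines all iterated
  sections \<open>\<Sum>f\<^bsub>pn+r\<^esub> X\<^sup>n\<close> to a finite set of series. Over the integers, a primitive annihilating
  polynomial reduces to a nonzero one modulo \<open>p\<close>.
\<close>

section \<open>Power-free numbers in arithmetic progressions\<close>

text \<open>Since \<open>a\<close> is invertible modulo \<open>d\<close>, all solutions
  \<open>j\<close> lie in one residue class, so each block of \<open>d\<close> consecutive indices
  contains at most one. The blocks that meet the range are numbered 0 to
  \<open>J div d\<close>.\<close>

lemma card_dvd_arith_prog_le:
  fixes a b d J :: nat
  assumes "coprime a d" "d > 0"
  shows "card {j\<in>{..<J}. d dvd a * j + b} \<le> J div d + 1"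
proof -
  let ?S = "{j\<in>{..<J}. d dvd a * j + b}"
  have "inj_on (\<lambda>j. j div d) ?S"
  proof (rule inj_onI)
    fix i j assume ij: "i \<in> ?S" "j \<in> ?S" and eq: "i div d = j div d"
    have "[a * i + b = a * j + b] (mod d)"
      using ij by (simp add: cong_def mod_eq_0_iff_dvd)
    then have "[i = j] (mod d)"
      using assms cong_mult_lcancel_nat cong_add_rcancel_nat by blast
    with eq show "i = j" by (metis cong_def div_mult_mod_eq)
  qed
  moreover have "(\<lambda>j. j div d) ` ?S \<subseteq> {..J div d}"
    by (auto intro: div_le_mono)
  ultimately have "card ?S \<le> card {..J div d}"
    by (intro card_inj_on_le) auto
  then show ?thesis by simp
qed

lemma sum_inverse_squares_le:
  "(\<Sum>n=2..s. 1 / real n ^ 2) \<le> 3/4"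
proof (cases "s \<ge> 2")
  case True
  \<comment> \<open>The term \<open>1 / real s\<close> makes the bound telescope. Keeping the first
    summand 1/4 exact gives equality at \<open>s = 2\<close> and a final constant below 1.\<close>
  then have "(\<Sum>n=2..s. 1 / real n ^ 2) \<le> 3/4 - 1 / real s"
  proof (induction s rule: dec_induct)
    case base
    show ?case by simp
  next
    case (step s)
    have "1 / real (Suc s) ^ 2 \<le> 1 / real s - 1 / real (Suc s)"
    proof -
      have "1 / real (Suc s) ^ 2 \<le> 1 / (real s * real (Suc s))"
        unfolding power2_eq_square using step.hyps by (intro divide_left_mono mult_right_mono) auto
      also have "\<dots> = 1 / real s - 1 / real (Suc s)"
        using step.hyps by (simp add: field_simps)
      finally show ?thesis .
    qed
    with step show ?case by simp
  qed
  then show ?thesis by (rule order_trans) simp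
qed simp

text \<open>If each of the first \<open>J\<close> terms had a square factor, the factors could be
  taken at most \<open>s\<close>, about the square root of \<open>a * J + b\<close>. Counting
  multiples then gives \<open>J <= 3/4 * J + s\<close>, which fails for large \<open>J\<close>
  because \<open>s\<close> grows only like the square root of \<open>J\<close>.\<close>

lemma squarefree_in_arith_prog:
  fixes a b :: nat
  assumes "coprime a b" "b > 0"
  obtains j where "\<And>p. prime p \<Longrightarrow> \<not> p ^ 2 dvd a * j + b"
proof (rule ccontr)
  assume "\<not> thesis"
  then have ex: "\<exists>p. prime p \<and> p ^ 2 dvd a * j + b" for j using that by blast
  \<comment> \<open>The count will yield
    \<open>J * J <= 16 * (a * J + b) <= 16 * (a + b) * J\<close>; this \<open>J\<close> is the first
    to violate it.\<close>
  define J where "J = 16 * (a + b) + 1"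
  define s where "s = nat \<lfloor>sqrt (real (a * J + b))\<rfloor>"
  let ?S = "\<lambda>d. {j\<in>{..<J}. d ^ 2 dvd a * j + b}"
  \<comment> \<open>Only coprimality to \<open>a\<close> is recorded about the prime: it is what the
    counting lemma asks for, and it holds because a common prime factor would also divide
    \<open>b\<close>.\<close>
  have "\<exists>d\<in>{d\<in>{2..s}. coprime a d}. j \<in> ?S d" if "j < J" for j
  proof -
    obtain p where p: "prime p" "p ^ 2 dvd a * j + b" using ex by blast
    have "p dvd a * j + b" using p(2) by (meson dvd_power dvd_trans zero_less_numeral)
    then have "\<not> p dvd a"
      using p(1) assms(1) by (metis coprime_common_divisor_nat dvd_add_right_iff dvd_mult2 not_prime_1)
    then have "coprime a p" using p(1) by (metis coprime_commute prime_imp_coprime)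
    moreover have "p \<ge> 2" using p(1) by (rule prime_ge_2_nat)
    moreover have "p \<le> s"
    proof -
      have "p ^ 2 \<le> a * j + b" using p(2) assms(2) by (intro dvd_imp_le) auto
      also have "\<dots> \<le> a * J + b" using that by simp
      finally have "real p ^ 2 \<le> real (a * J + b)"
        by (metis of_nat_le_iff of_nat_power)
      then have "real p \<le> sqrt (real (a * J + b))" by (rule real_le_rsqrt)
      then show ?thesis unfolding s_def by (rule le_nat_floor)
    qed
    ultimately show ?thesis using p that by auto
  qed
  then have "{..<J} \<subseteq> (\<Union>d\<in>{d\<in>{2..s}. coprime a d}. ?S d)" by blast
  then have "card {..<J} \<le> card (\<Union>d\<in>{d\<in>{2..s}. coprime a d}. ?S d)"
    by (intro card_mono) auto
  also have "\<dots> \<le> (\<Sum>d\<in>{d\<in>{2..s}. coprime a d}. card (?S d))"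
    by (rule card_UN_le) simp
  also have "\<dots> \<le> (\<Sum>d\<in>{d\<in>{2..s}. coprime a d}. J div d ^ 2 + 1)"
    by (intro sum_mono card_dvd_arith_prog_le) auto
  also have "\<dots> \<le> (\<Sum>d=2..s. J div d ^ 2 + 1)"
    by (intro sum_mono2) auto
  finally have "real J \<le> real (\<Sum>d=2..s. J div d ^ 2 + 1)" by (simp only: card_lessThan of_nat_le_iff)
  also have "\<dots> = (\<Sum>d=2..s. real (J div d ^ 2)) + real (s - 1)"
    by (simp add: sum.distrib)
  also have "(\<Sum>d=2..s. real (J div d ^ 2)) \<le> (\<Sum>d=2..s. real J * (1 / real d ^ 2))"
  proof (intro sum_mono)
    fix d show "real (J div d ^ 2) \<le> real J * (1 / real d ^ 2)"
      using of_nat_div_le_of_nat[of J "d ^ 2"] by simp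
  qed
  also have "\<dots> = real J * (\<Sum>d=2..s. 1 / real d ^ 2)" by (simp only: sum_distrib_left)
  also have "\<dots> \<le> real J * (3/4)"
    by (intro mult_left_mono sum_inverse_squares_le) auto
  finally have "J \<le> 4 * s" by simp
  have "real s \<le> sqrt (real (a * J + b))" unfolding s_def by simp
  then have "real s ^ 2 \<le> real (a * J + b)"
    using power_mono[of "real s" "sqrt (real (a * J + b))" 2] by simp
  then have s: "s ^ 2 \<le> a * J + b" by (metis of_nat_le_iff of_nat_power)
  have "J * J \<le> (4 * s) * (4 * s)" using \<open>J \<le> 4 * s\<close> by (intro mult_mono) auto
  also have "\<dots> = 16 * s ^ 2" by (simp add: power2_eq_square)
  also have "\<dots> \<le> 16 * (a * J + b)" using s by simp
  also have "\<dots> \<le> 16 * (a + b) * J" unfolding J_def by (simp add: algebra_simps)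
  finally have "J \<le> 16 * (a + b)" unfolding J_def by simp
  then show False unfolding J_def by simp
qed

section \<open>Distinct kernel sequences and non-automaticity\<close>

lemma qfree_kernel_separation:
  fixes k l l' m :: nat
  assumes "m \<ge> 2" "k \<ge> 2" "l < l'"
  obtains n where "n \<ge> 1" "qfree m (k ^ l * n + 1) = 0" "qfree m (k ^ l' * n + 1) = 1"
proof -
  \<comment> \<open>This size keeps \<open>p\<close> from dividing \<open>k\<close> or the positive
    number \<open>k ^ (l' - l) - 1\<close>. The latter ensures that \<open>p\<close> cannot divide
    both \<open>k ^ l * n + 1\<close> and \<open>k ^ l' * n + 1\<close>.\<close>
  obtain p where p: "prime p" "p > k ^ l'" using bigger_prime by blast
  define P where "P = p ^ m"
  have P: "P > 1" unfolding P_def using prime_gt_1_nat[OF p(1)] assms(1) by (intro one_less_power) auto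
  have pk: "\<not> p dvd k"
  proof
    assume "p dvd k"
    then have "p \<le> k" using assms(2) by (intro dvd_imp_le) auto
    also have "k \<le> k ^ l'" using assms by (intro self_le_power) auto
    finally show False using p(2) by simp
  qed
  have cop: "coprime k p" using pk p(1) by (metis coprime_commute prime_imp_coprime)
  then have "coprime (k ^ l) P" unfolding P_def by simp
  then obtain x where x: "[k ^ l * x = 1] (mod P)"
    using cong_solve_coprime_nat by (metis One_nat_def)
  \<comment> \<open>Here \<open>x\<close> inverts \<open>k ^ l\<close> modulo \<open>P\<close>, and
    \<open>P - 1\<close> stands for -1 within the natural numbers, so \<open>k ^ l * n0\<close> is
    -1 modulo \<open>P\<close>.\<close>
  define n0 where "n0 = x * (P - 1)"
  have "[k ^ l * x * (P - 1) + 1 = 1 * (P - 1) + 1] (mod P)"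
    by (intro cong_add cong_mult x cong_refl)
  then have u: "P dvd k ^ l * n0 + 1"
    unfolding n0_def using P by (simp add: mult.assoc cong_def mod_eq_0_iff_dvd)
  have n0: "n0 \<ge> 1" using u P by (cases n0) auto
  \<comment> \<open>Substituting \<open>n = n0 + P * j\<close> keeps \<open>k ^ l * n + 1\<close>
    divisible by \<open>P\<close> and turns \<open>k ^ l' * n + 1\<close> into
    \<open>a * j + b\<close>.\<close>
  define a where "a = k ^ l' * P"
  define b where "b = k ^ l' * n0 + 1"
  have "\<not> p dvd b"
  proof
    assume pb: "p dvd b"
    have "p dvd k ^ l * n0 + 1"
      using u assms(1) unfolding P_def by (meson dvd_power dvd_trans zero_less_numeral less_le_trans)
    then have "p dvd k ^ (l' - l) * (k ^ l * n0 + 1)" by (rule dvd_mult)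
    also have "k ^ (l' - l) * (k ^ l * n0 + 1) = b + (k ^ (l' - l) - 1)"
      using assms unfolding b_def
      by (simp add: algebra_simps flip: power_add)
    finally have "p dvd k ^ (l' - l) - 1" using pb by (simp add: dvd_add_right_iff)
    moreover have "k ^ (l' - l) > 1" using assms by (intro one_less_power) auto
    ultimately have "p \<le> k ^ (l' - l) - 1" by (intro dvd_imp_le) auto
    also have "\<dots> < k ^ (l' - l)" using \<open>k ^ (l' - l) > 1\<close> by simp
    also have "\<dots> \<le> k ^ l'" using assms by (intro power_increasing) auto
    finally show False using p(2) by simp
  qed
  then have "coprime P b" unfolding P_def using p(1) by (simp add: prime_imp_coprime)
  moreover have "coprime (k ^ l') b"
    unfolding b_def by (metis coprime_add_one_right coprime_mult_left_iff)
  ultimately have "coprime a b" unfolding a_def by simp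
  then obtain j where j: "\<And>q. prime q \<Longrightarrow> \<not> q ^ 2 dvd a * j + b"
    using squarefree_in_arith_prog[of a b] unfolding b_def by auto
  show ?thesis
  proof
    show "n0 + P * j \<ge> 1" using n0 by simp
    have "k ^ l * (n0 + P * j) + 1 = (k ^ l * n0 + 1) + P * (k ^ l * j)"
      by (simp add: algebra_simps)
    then have "p ^ m dvd k ^ l * (n0 + P * j) + 1"
      using u unfolding P_def by (metis dvd_add dvd_triv_left)
    then show "qfree m (k ^ l * (n0 + P * j) + 1) = 0"
      unfolding qfree_def using p(1) by auto
    have "k ^ l' * (n0 + P * j) + 1 = a * j + b"
      unfolding a_def b_def by (simp add: algebra_simps)
    moreover have "\<not> q ^ m dvd a * j + b" if "prime q" for q
      using j[OF that] assms(1) by (meson dvd_trans le_imp_power_dvd)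
    ultimately show "qfree m (k ^ l' * (n0 + P * j) + 1) = 1"
      unfolding qfree_def by auto
  qed
qed

lemma qfree_not_automatic:
  assumes "m \<ge> 2" "k \<ge> 2"
  shows "\<not> automatic k (qfree m)"
proof
  assume "automatic k (qfree m)"
  then have fin: "finite (kernel_seqs k (qfree m))" by (simp add: automatic_def)
  let ?g = "\<lambda>l. \<lambda>n\<in>{1..}. qfree m (k ^ l * n + 1)"
  have "?g ` {1..} \<subseteq> kernel_seqs k (qfree m)"
  proof
    fix t assume "t \<in> ?g ` {1..}"
    then obtain l where l: "l \<ge> 1" "t = ?g l" by auto
    \<comment> \<open>Level 0 is left out because the offset 1 must be smaller than
      \<open>k ^ l\<close>.\<close>
    then have "1 < k ^ l" using assms by (intro one_less_power) auto
    with l show "t \<in> kernel_seqs k (qfree m)" unfolding kernel_seqs_def by blast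
  qed
  then have "finite (?g ` {1..})" using fin finite_subset by blast
  then have "\<not> inj_on ?g {1..}" using finite_imageD infinite_Ici by blast
  then obtain l l' where ll: "l < l'" and eq: "?g l = ?g l'"
    unfolding inj_on_def by (metis nat_neq_iff)
  obtain n where n: "n \<ge> 1" "qfree m (k ^ l * n + 1) = 0" "qfree m (k ^ l' * n + 1) = 1"
    using qfree_kernel_separation[OF assms ll] .
  show False using fun_cong[OF eq, of n] n by simp
qed

section \<open>Algebraic power series\<close>

interpretation fps_of_poly_hom: comm_ring_hom "fps_of_poly :: 'a::comm_ring_1 poly \<Rightarrow> 'a fps"
  by unfold_locales (simp_all add: fps_of_poly_add fps_of_poly_mult)

text \<open>A denominator-free form of algebraicity over the rational functions: the coefficients of
  \<open>P\<close> are themselves polynomials, so evaluation stays inside the ring of power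
  series.\<close>

definition algebraic_series :: "'a::idom fps \<Rightarrow> bool" where
  "algebraic_series f \<longleftrightarrow> (\<exists>P. P \<noteq> 0 \<and> poly (map_poly fps_of_poly P) f = 0)"

lemma not_transcendental_imp_algebraic_series:
  fixes f :: "'a::idom fps"
  assumes "\<not> transcendental_series f"
  shows "algebraic_series f"
proof -
  let ?R = "ring_of_type_algebra :: 'a fps fract ring"
  let ?K = "rational_functions :: 'a fps fract set"
  interpret R: field ?R by (rule field_from_type_algebra)
  have K: "subring ?K ?R" using subfieldE(1)[OF subfield_rational_functions] .
  have "(R.algebraic over ?K) (to_fract f)"
    using assms unfolding transcendental_series_def over_def by simp
  then obtain p where p: "p \<in> carrier (?K[X]\<^bsub>?R\<^esub>)" "p \<noteq> []" "R.eval p (to_fract f) = \<zero>\<^bsub>?R\<^esub>"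
    using R.algebraicE[OF K, of "to_fract f"] by (auto simp: ring_of_type_algebra_def)
  have ops: "\<zero>\<^bsub>?R\<^esub> = 0" "x \<otimes>\<^bsub>?R\<^esub> y = x * y" "x \<oplus>\<^bsub>?R\<^esub> y = x + y" for x y
    by (simp_all add: ring_of_type_algebra_def)
  have pow: "x [^]\<^bsub>?R\<^esub> (n::nat) = x ^ n" for x n
    by (induction n) (auto simp: ring_of_type_algebra_def mult.commute)
  \<comment> \<open>The head of the list \<open>p\<close> is its leading coefficient, and
    \<open>D\<close> is a common denominator of all entries. The bound on the support of
    \<open>P\<close> ensures that the monomial added for a new head cannot cancel.\<close>
  have clear_denominators: "\<exists>D P. D \<noteq> 0 \<and> (\<forall>n\<ge>length p. poly.coeff P n = 0)
      \<and> to_fract (poly (map_poly fps_of_poly P) f) = to_fract (fps_of_poly D) * R.eval p (to_fract f)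
      \<and> (p \<noteq> [] \<longrightarrow> hd p \<noteq> 0 \<longrightarrow> P \<noteq> 0)"
    if "set p \<subseteq> ?K" for p
    using that
  proof (induction p)
    case Nil
    show ?case
      by (rule exI[of _ 1], rule exI[of _ 0]) (simp add: ops)
  next
    case (Cons c p)
    then obtain D P where D: "D \<noteq> 0" and P: "\<forall>n\<ge>length p. poly.coeff P n = 0"
      and eq: "to_fract (poly (map_poly fps_of_poly P) f)
        = to_fract (fps_of_poly D) * R.eval p (to_fract f)"
      by auto
    from Cons.prems obtain a b where c: "c = to_fract (fps_of_poly a) / to_fract (fps_of_poly b)"
      and b: "b \<noteq> 0" unfolding rational_functions_def by auto
    define Q where "Q = Polynomial.monom (a * D) (length p) + smult b P"
    have "b * D \<noteq> 0" using b D by simp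
    moreover have "\<forall>n\<ge>length (c # p). poly.coeff Q n = 0"
      using P unfolding Q_def by simp
    moreover have "to_fract (poly (map_poly fps_of_poly Q) f)
        = to_fract (fps_of_poly (b * D)) * R.eval (c # p) (to_fract f)"
    proof -
      have ev: "R.eval (c # p) (to_fract f) = c * to_fract f ^ length p + R.eval p (to_fract f)"
        by (simp add: pow ops)
      have pw: "to_fract (g ^ n) = to_fract g ^ n" for g :: "'a fps" and n
        by (induction n) auto
      have "to_fract (poly (map_poly fps_of_poly Q) f)
          = to_fract (fps_of_poly a) * to_fract (fps_of_poly D) * to_fract f ^ length p
            + to_fract (fps_of_poly b) * to_fract (poly (map_poly fps_of_poly P) f)"
        unfolding Q_def
        by (simp add: fps_of_poly_hom.map_poly_hom_add fps_of_poly_hom.map_poly_hom_smult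
            poly_monom fps_of_poly_mult pw)
      also have "to_fract (fps_of_poly a) = to_fract (fps_of_poly b) * c"
        using b unfolding c by simp
      finally show ?thesis
        unfolding ev eq fps_of_poly_mult to_fract_mult by (simp only: algebra_simps)
    qed
    moreover have "c \<noteq> 0 \<longrightarrow> Q \<noteq> 0"
    proof
      assume "c \<noteq> 0"
      then have "a \<noteq> 0" unfolding c by auto
      then have "poly.coeff Q (length p) \<noteq> 0" using P D unfolding Q_def by simp
      then show "Q \<noteq> 0" by auto
    qed
    ultimately show ?case by (intro exI[of _ "b * D"] exI[of _ Q]) auto
  qed
  have "set p \<subseteq> ?K" "hd p \<noteq> 0"
    using p(1,2) unfolding univ_poly_carrier[symmetric] polynomial_def
    by (auto simp: ops)
  then obtain P where "P \<noteq> 0" "to_fract (poly (map_poly fps_of_poly P) f) = 0"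
    using clear_denominators[of p] p(2,3) unfolding ops by auto
  then show ?thesis unfolding algebraic_series_def by auto
qed

section \<open>Linear relations among powers of an algebraic series\<close>

lemma linear_dependence_idom:
  fixes v :: "'i \<Rightarrow> nat \<Rightarrow> 'a::idom"
  assumes "finite I" "card I > n"
  shows "\<exists>c. (\<exists>i\<in>I. c i \<noteq> 0) \<and> (\<forall>j<n. (\<Sum>i\<in>I. c i * v i j) = 0)"
  using assms
proof (induction n arbitrary: I v)
  case 0
  then show ?case by (intro exI[of _ "\<lambda>_. 1"]) (auto simp: card_gt_0_iff)
next
  case (Suc n)
  show ?case
  proof (cases "\<forall>i\<in>I. v i n = 0")
    case True
    obtain c where "\<exists>i\<in>I. c i \<noteq> 0" "\<forall>j<n. (\<Sum>i\<in>I. c i * v i j) = 0"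
      using Suc.IH[of I v] Suc.prems by auto
    with True show ?thesis by (intro exI[of _ c]) (auto simp: less_Suc_eq)
  next
    case False
    then obtain i0 where i0: "i0 \<in> I" "v i0 n \<noteq> 0" by blast
    define I' where "I' = I - {i0}"
    have I': "finite I'" "card I' > n" "i0 \<notin> I'" "I = insert i0 I'"
      unfolding I'_def using Suc.prems i0 by auto
    \<comment> \<open>Gaussian elimination without division: cross-multiplying with the pivot row
      \<open>i0\<close> annihilates coordinate \<open>n\<close>, leaving one vector and one
      coordinate fewer.\<close>
    obtain c where c: "\<exists>i\<in>I'. c i \<noteq> 0"
        "\<forall>j<n. (\<Sum>i\<in>I'. c i * (v i0 n * v i j - v i n * v i0 j)) = 0"
      using Suc.IH[OF I'(1,2), of "\<lambda>i j. v i0 n * v i j - v i n * v i0 j"] by blast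
    define d where "d = (\<lambda>i. if i = i0 then - (\<Sum>i\<in>I'. c i * v i n) else c i * v i0 n)"
    have "\<exists>i\<in>I. d i \<noteq> 0" using c(1) i0 I'(3,4) unfolding d_def by auto
    moreover have "(\<Sum>i\<in>I. d i * v i j) = 0" if "j < Suc n" for j
    proof -
      have "(\<Sum>i\<in>I. d i * v i j)
          = - (\<Sum>i\<in>I'. c i * v i n) * v i0 j + (\<Sum>i\<in>I'. d i * v i j)"
        unfolding I'(4) using I'(1,3) by (simp add: d_def)
      also have "(\<Sum>i\<in>I'. d i * v i j) = (\<Sum>i\<in>I'. c i * v i0 n * v i j)"
        using I'(3) by (intro sum.cong) (auto simp: d_def)
      also have "- (\<Sum>i\<in>I'. c i * v i n) * v i0 j + \<dots>
          = (\<Sum>i\<in>I'. c i * (v i0 n * v i j - v i n * v i0 j))"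
        by (simp add: sum_distrib_right right_diff_distrib sum_subtractf mult.assoc)
      also have "\<dots> = 0"
        using c(2) that by (cases "j = n") (simp_all add: mult.commute less_Suc_eq)
      finally show ?thesis .
    qed
    ultimately show ?thesis by blast
  qed
qed

text \<open>Up to nonzero polynomial factors, every power of \<open>f\<close> is a combination of
  the powers with exponent below \<open>d\<close>, the degree of an annihilating polynomial. Any
  \<open>d + 1\<close> powers are therefore dependent, whatever exponents \<open>e\<close>
  selects.\<close>

lemma algebraic_series_power_relation:
  fixes f :: "'a::idom fps" and e :: "nat \<Rightarrow> nat"
  assumes "algebraic_series f"
  obtains N a where "\<exists>i\<le>N. a i \<noteq> 0" "(\<Sum>i\<le>N. fps_of_poly (a i) * f ^ e i) = 0"
proof -
  let ?ev = "\<lambda>Q. poly (map_poly fps_of_poly Q) f"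
  have ev_add: "?ev (A + B) = ?ev A + ?ev B" for A B
    by (simp only: fps_of_poly_hom.map_poly_hom_add poly_add)
  have ev_smult: "?ev (smult c A) = fps_of_poly c * ?ev A" for c A
    by (simp only: fps_of_poly_hom.map_poly_hom_smult poly_smult)
  have ev_mult: "?ev (A * B) = ?ev A * ?ev B" for A B
  proof (induction A)
    case (pCons a A)
    then show ?case
      by (simp only: mult_pCons_left ev_add ev_smult fps_of_poly_hom.map_poly_pCons_hom poly_pCons
          fps_of_poly_hom.hom_zero) (simp only: algebra_simps add_0_left)
  qed simp
  have ev_sum: "?ev (\<Sum>i\<in>I. A i) = (\<Sum>i\<in>I. ?ev (A i))" for A and I :: "nat set"
    by (induction I rule: infinite_finite_induct) (simp_all add: ev_add)
  obtain P where P: "P \<noteq> 0" "?ev P = 0" using assms unfolding algebraic_series_def by blast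
  define d where "d = degree P"
  have "\<forall>i. \<exists>b R. b \<noteq> 0 \<and> fps_of_poly b * f ^ e i = ?ev R \<and> (\<forall>j\<ge>d. poly.coeff R j = 0)"
  proof
    fix i
    \<comment> \<open>The leading coefficient of \<open>P\<close> need not be a unit, so only a
      nonzero multiple \<open>b\<close> of the monomial can be reduced modulo
      \<open>P\<close>.\<close>
    define R where "R = pseudo_mod (Polynomial.monom 1 (e i)) P"
    obtain b Q where b: "b \<noteq> 0" "smult b (Polynomial.monom 1 (e i)) = P * Q + R"
      using pseudo_mod(1)[OF P(1), of "Polynomial.monom 1 (e i)"] unfolding R_def by blast
    have "?ev (smult b (Polynomial.monom 1 (e i))) = ?ev (P * Q + R)" by (simp only: b(2))
    then have "fps_of_poly b * f ^ e i = ?ev R"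
      unfolding ev_add ev_mult ev_smult P(2) by (simp add: poly_monom)
    moreover have "\<forall>j\<ge>d. poly.coeff R j = 0"
      using pseudo_mod(2)[OF P(1), of "Polynomial.monom 1 (e i)"]
      unfolding R_def[symmetric] d_def by (auto intro: coeff_eq_0)
    ultimately show "\<exists>b R. b \<noteq> 0 \<and> fps_of_poly b * f ^ e i = ?ev R \<and> (\<forall>j\<ge>d. poly.coeff R j = 0)"
      using b(1) by blast
  qed
  from choice[OF this] obtain b where "\<forall>i. \<exists>R. b i \<noteq> 0
      \<and> fps_of_poly (b i) * f ^ e i = ?ev R \<and> (\<forall>j\<ge>d. poly.coeff R j = 0)" ..
  from choice[OF this] obtain R where "\<forall>i. b i \<noteq> 0
      \<and> fps_of_poly (b i) * f ^ e i = ?ev (R i) \<and> (\<forall>j\<ge>d. poly.coeff (R i) j = 0)" ..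
  then have b: "\<And>i. b i \<noteq> 0" and bR: "\<And>i. fps_of_poly (b i) * f ^ e i = ?ev (R i)"
    and R: "\<And>i j. j \<ge> d \<Longrightarrow> poly.coeff (R i) j = 0" by blast+
  obtain c where c: "\<exists>i\<in>{..d}. c i \<noteq> 0"
      "\<forall>j<d. (\<Sum>i\<in>{..d}. c i * poly.coeff (R i) j) = 0"
    using linear_dependence_idom[OF finite_atMost, of d d "\<lambda>i j. poly.coeff (R i) j"]
    by (simp only: card_atMost lessI) blast
  have "(\<Sum>i\<le>d. smult (c i) (R i)) = 0"
  proof (rule poly_eqI)
    fix j
    show "poly.coeff (\<Sum>i\<le>d. smult (c i) (R i)) j = poly.coeff 0 j"
      unfolding coeff_sum coeff_smult coeff_0
      using c(2) R by (cases "j < d") auto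
  qed
  then have "0 = ?ev (\<Sum>i\<le>d. smult (c i) (R i))" by simp
  also have "\<dots> = (\<Sum>i\<le>d. fps_of_poly (c i) * ?ev (R i))"
    by (simp only: ev_sum ev_smult)
  also have "\<dots> = (\<Sum>i\<le>d. fps_of_poly (c i * b i) * f ^ e i)"
    by (simp only: fps_of_poly_mult mult.assoc bR)
  finally have "(\<Sum>i\<le>d. fps_of_poly (c i * b i) * f ^ e i) = 0" by simp
  moreover have "\<exists>i\<le>d. c i * b i \<noteq> 0" using c(1) b by auto
  ultimately show ?thesis by (intro that[of d "\<lambda>i. c i * b i"])
qed

section \<open>Sections of algebraic power series over a prime field\<close>

text \<open>Over the prime field with \<open>q\<close> elements these are the Cartier operators, for
  \<open>r < q\<close>.\<close>

definition fps_section :: "nat \<Rightarrow> nat \<Rightarrow> 'a::zero fps \<Rightarrow> 'a fps" where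
  "fps_section q r f = Abs_fps (\<lambda>n. fps_nth f (q * n + r))"

definition poly_section :: "nat \<Rightarrow> nat \<Rightarrow> 'a::zero poly \<Rightarrow> 'a poly" where
  "poly_section q r a = Poly (map (\<lambda>n. poly.coeff a (q * n + r)) [0..<Suc (degree a)])"

lemma fps_section_nth [simp]: "fps_nth (fps_section q r f) n = fps_nth f (q * n + r)"
  by (simp add: fps_section_def)

lemma coeff_poly_section:
  assumes "q > 0"
  shows "poly.coeff (poly_section q r a) n = poly.coeff a (q * n + r)"
proof (cases "n \<le> degree a")
  case False
  then have "degree a < q * n + r" using assms mult_le_mono1[of 1 q n] by linarith
  with False show ?thesis
    unfolding poly_section_def by (simp add: nth_default_def coeff_eq_0 del: upt_Suc)
qed (simp add: poly_section_def nth_default_def del: upt_Suc)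

lemma fps_of_poly_section:
  "q > 0 \<Longrightarrow> fps_of_poly (poly_section q r a) = fps_section q r (fps_of_poly a)"
  by (rule fps_ext) (simp add: coeff_poly_section)

lemma degree_poly_section_le:
  assumes "q > 0" "degree a \<le> q * D"
  shows "degree (poly_section q r a) \<le> D"
proof (rule degree_le, intro allI impI)
  fix n assume "n > D"
  then have "q * n > degree a" using assms by (meson le_less_trans mult_less_mono2)
  then show "poly.coeff (poly_section q r a) n = 0"
    using assms(1) by (simp add: coeff_poly_section coeff_eq_0)
qed

text \<open>The leading coefficient survives in the section belonging to the residue of the degree
  modulo \<open>q\<close>.\<close>

lemma poly_section_nonzero:
  assumes "q > 0" "a \<noteq> 0"
  obtains r where "r < q" "poly_section q r a \<noteq> 0"
proof
  show "degree a mod q < q" using assms by simp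
  have "poly.coeff (poly_section q (degree a mod q) a) (degree a div q) = lead_coeff a"
    using assms by (simp add: coeff_poly_section)
  then show "poly_section q (degree a mod q) a \<noteq> 0" using assms by auto
qed

lemma fps_section_sum: "fps_section q r (\<Sum>i\<in>A. f i) = (\<Sum>i\<in>A. fps_section q r (f i))"
  for f :: "'i \<Rightarrow> 'a::comm_monoid_add fps"
  by (rule fps_ext) (simp add: fps_sum_nth)

section \<open>Frobenius and its interaction with sections\<close>

lemma fps_frobenius_nth:
  fixes h :: "'p::prime_card mod_ring fps"
  shows "fps_nth (h ^ CARD('p)) n = (if CARD('p) dvd n then fps_nth h (n div CARD('p)) else 0)"
proof (induction n arbitrary: h rule: less_induct)
  case (less n)
  let ?q = "CARD('p)"
  have q: "prime ?q" by (rule prime_card)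
  then have q0: "?q > 0" by (simp add: prime_gt_0_nat)
  \<comment> \<open>The power map is additive in characteristic \<open>?q\<close> and fixes
    constants of the prime field. Splitting off the constant term thus reduces the coefficient at
    \<open>n\<close> of the power of \<open>h\<close> to that at \<open>n - ?q\<close> of the power
    of \<open>g\<close>.\<close>
  define g where "g = fps_shift 1 h"
  have "h = fps_const (fps_nth h 0) + g * fps_X"
    unfolding g_def by (rule fps_ext) simp
  then have "h ^ ?q = (fps_const (fps_nth h 0) + g * fps_X) ^ ?q" by (rule arg_cong)
  also have "\<dots> = fps_const (fps_nth h 0) ^ ?q + (g * fps_X) ^ ?q"
    using q by (intro freshmans_dream) simp_all
  also have "fps_const (fps_nth h 0) ^ ?q = fps_const (fps_nth h 0)"
    using finite_field_power_card_eq_same[of "fps_nth h 0"] by (simp add: fps_const_power)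
  finally have *: "h ^ ?q = fps_const (fps_nth h 0) + g ^ ?q * fps_X ^ ?q"
    by (simp add: power_mult_distrib)
  consider "n = 0" | "n > 0" "n < ?q" | "n \<ge> ?q" by linarith
  then show ?case
  proof cases
    case 1
    then show ?thesis using q0 by (simp add: * fps_X_power_mult_right_nth)
  next
    case 2
    then have "\<not> ?q dvd n" by (auto dest: dvd_imp_le)
    with 2 show ?thesis by (simp add: * fps_X_power_mult_right_nth)
  next
    case 3
    have d: "?q dvd n - ?q \<longleftrightarrow> ?q dvd n" using 3 by (metis dvd_minus_self not_less)
    have "n div ?q = Suc ((n - ?q) div ?q)" using 3 q0 by (simp add: le_div_geq)
    moreover have "fps_nth (g ^ ?q) (n - ?q) = (if ?q dvd n then fps_nth g ((n - ?q) div ?q) else 0)"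
      using less.IH[of "n - ?q" g] 3 q0 d by simp
    moreover have "fps_nth (h ^ ?q) n = fps_nth (g ^ ?q) (n - ?q)"
      using 3 q0 by (auto simp: * fps_X_power_mult_right_nth)
    ultimately show ?thesis by (simp add: g_def)
  qed
qed

text \<open>A \<open>q\<close>-th power has nonzero coefficients only at multiples of
  \<open>q\<close>, so the convolution collapses to one between \<open>h\<close> and the section of
  \<open>g\<close>.\<close>

lemma fps_section_mult_frobenius:
  fixes g h :: "'p::prime_card mod_ring fps"
  assumes "r < CARD('p)"
  shows "fps_section CARD('p) r (g * h ^ CARD('p)) = fps_section CARD('p) r g * h"
proof (rule fps_ext)
  fix n
  let ?q = "CARD('p)"
  have "fps_nth (fps_section ?q r (g * h ^ ?q)) n
      = (\<Sum>i=0..?q * n + r. fps_nth (h ^ ?q) i * fps_nth g (?q * n + r - i))"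
    by (simp add: mult.commute[of g] fps_mult_nth)
  also have "\<dots> = (\<Sum>i\<in>(\<lambda>j. ?q * j) ` {0..n}. fps_nth (h ^ ?q) i * fps_nth g (?q * n + r - i))"
  proof (rule sum.mono_neutral_right)
    show "(\<lambda>j. ?q * j) ` {0..n} \<subseteq> {0..?q * n + r}" by (auto intro!: trans_le_add1)
    show "\<forall>i\<in>{0..?q * n + r} - (\<lambda>j. ?q * j) ` {0..n}.
        fps_nth (h ^ ?q) i * fps_nth g (?q * n + r - i) = 0"
    proof
      fix i assume i: "i \<in> {0..?q * n + r} - (\<lambda>j. ?q * j) ` {0..n}"
      have "\<not> ?q dvd i"
      proof
        assume "?q dvd i"
        then obtain j where j: "i = ?q * j" by blast
        have "?q * j < ?q * (n + 1)" using i j assms by simp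
        then have "j \<le> n" by (simp only: mult_less_cancel1) simp
        with i j show False by auto
      qed
      then show "fps_nth (h ^ ?q) i * fps_nth g (?q * n + r - i) = 0"
        by (simp add: fps_frobenius_nth)
    qed
  qed simp
  also have "\<dots> = (\<Sum>j=0..n. fps_nth (h ^ ?q) (?q * j) * fps_nth g (?q * n + r - ?q * j))"
    by (subst sum.reindex) (auto simp: inj_on_def)
  also have "\<dots> = (\<Sum>j=0..n. fps_nth h j * fps_nth (fps_section ?q r g) (n - j))"
    by (intro sum.cong) (auto simp: fps_frobenius_nth diff_mult_distrib2)
  also have "\<dots> = fps_nth (fps_section ?q r g * h) n"
    by (simp add: mult.commute[of _ h] fps_mult_nth)
  finally show "fps_nth (fps_section ?q r (g * h ^ ?q)) n = fps_nth (fps_section ?q r g * h) n" .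
qed

text \<open>If the coefficient of \<open>f\<close> vanishes, every remaining term is a polynomial
  times a \<open>q\<close>-th power. A section then lowers all exponents by a factor
  \<open>q\<close> and shifts the coefficients down by one index; repeating this brings a nonzero
  coefficient to index 0.\<close>

lemma algebraic_series_ore_relation:
  fixes f :: "'p::prime_card mod_ring fps"
  assumes "algebraic_series f"
  obtains N a where "a 0 \<noteq> 0" "(\<Sum>i\<le>N. fps_of_poly (a i) * f ^ (CARD('p) ^ i)) = 0"
proof -
  let ?q = "CARD('p)"
  let ?rel = "\<lambda>N a. (\<Sum>i\<le>N. fps_of_poly (a i) * f ^ (?q ^ i)) = 0"
  have q0: "?q > 0" by simp
  have reduce: "\<exists>N a. a 0 \<noteq> 0 \<and> ?rel N a" if "j \<le> N" "a j \<noteq> 0" "?rel N a" for j N a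
    using that
  proof (induction j arbitrary: N a)
    case 0
    then show ?case by blast
  next
    case (Suc j)
    show ?case
    proof (cases "a 0 = 0")
      case False
      with Suc.prems show ?thesis by blast
    next
      case True
      from Suc.prems obtain M where N: "N = Suc M" "j \<le> M" by (cases N) auto
      \<comment> \<open>The residue is chosen so that the tracked coefficient stays nonzero; it now
        sits at index \<open>j\<close>.\<close>
      obtain r where r: "r < ?q" "poly_section ?q r (a (Suc j)) \<noteq> 0"
        using poly_section_nonzero[OF q0 Suc.prems(2)] .
      have "0 = fps_section ?q r (\<Sum>i\<le>Suc M. fps_of_poly (a i) * f ^ (?q ^ i))"
        using Suc.prems(3) unfolding N by (intro fps_ext) simp
      also have "(\<Sum>i\<le>Suc M. fps_of_poly (a i) * f ^ (?q ^ i))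
          = (\<Sum>i\<le>M. fps_of_poly (a (Suc i)) * (f ^ (?q ^ i)) ^ ?q)"
        by (simp only: sum.atMost_Suc_shift True) (simp add: power_mult[symmetric] mult.commute)
      also have "fps_section ?q r \<dots> = (\<Sum>i\<le>M. fps_of_poly (poly_section ?q r (a (Suc i))) * f ^ (?q ^ i))"
        by (simp only: fps_section_sum fps_section_mult_frobenius[OF r(1)] fps_of_poly_section[OF q0])
      finally show ?thesis
        using Suc.IH[of M "\<lambda>i. poly_section ?q r (a (Suc i))"] N r(2) by simp
    qed
  qed
  obtain N a where Na: "\<exists>i\<le>N. a i \<noteq> 0" "?rel N a"
    using algebraic_series_power_relation[OF assms, of "\<lambda>i. ?q ^ i"] .
  then obtain j where "j \<le> N" "a j \<noteq> 0" by blast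
  then obtain M b where "b 0 \<noteq> 0" "?rel M b" using reduce[OF _ _ Na(2)] by blast
  then show ?thesis by (rule that)
qed

section \<open>Finiteness of the set of iterated sections\<close>

lemma finite_degree_le: "finite {p :: 'a::{finite,zero} poly. degree p \<le> D}"
proof (rule finite_subset)
  show "{p :: 'a poly. degree p \<le> D} \<subseteq> Poly ` {xs. set xs \<subseteq> UNIV \<and> length xs \<le> Suc D}"
  proof
    fix p :: "'a poly" assume "p \<in> {p. degree p \<le> D}"
    then have "length (coeffs p) \<le> Suc D" by (cases "p = 0") (auto simp: length_coeffs_degree)
    then show "p \<in> Poly ` {xs. set xs \<subseteq> UNIV \<and> length xs \<le> Suc D}"
      by (intro image_eqI[of _ _ "coeffs p"]) auto
  qed
  show "finite (Poly ` {xs :: 'a list. set xs \<subseteq> UNIV \<and> length xs \<le> Suc D})"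
    by (intro finite_imageI finite_lists_length_le) simp
qed

lemma algebraic_series_finite_section_closed:
  fixes f :: "'p::prime_card mod_ring fps"
  assumes "algebraic_series f"
  obtains S where "finite S" "f \<in> S"
    "\<forall>h\<in>S. \<forall>r<CARD('p). fps_section CARD('p) r h \<in> S"
proof -
  let ?q = "CARD('p)"
  let ?F = "\<lambda>i. f ^ (?q ^ i)"
  have q2: "?q \<ge> 2" using prime_ge_2_nat prime_card by blast
  obtain N a where a0: "a 0 \<noteq> 0" and rel: "(\<Sum>i\<le>N. fps_of_poly (a i) * ?F i) = 0"
    using algebraic_series_ore_relation[OF assms] .
  define A where "A = fps_of_poly (a 0)"
  have A: "A \<noteq> 0" using a0 unfolding A_def by simp
  define D where "D = Max ((\<lambda>i. degree (a i)) ` {..N})"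
  have D: "degree (a i) \<le> D" if "i \<le> N" for i
    unfolding D_def using that by (intro Max_ge) auto
  have shift: "(\<Sum>i\<le>N. fps_of_poly (c i) * ?F i)
      = fps_of_poly (c 0) * f + (\<Sum>i<N. fps_of_poly (c (Suc i)) * ?F i ^ ?q)" for c
    by (simp only: sum.atMost_shift) (simp add: power_mult[symmetric] mult.commute)
  \<comment> \<open>Over a finite field there are finitely many coefficient choices
    \<open>c\<close>, and each determines at most one \<open>h\<close> since \<open>A\<close> can be
    cancelled.\<close>
  define S where "S = {h. \<exists>c. (\<forall>i\<le>N. degree (c i) \<le> D)
      \<and> A * h = (\<Sum>i\<le>N. fps_of_poly (c i) * ?F i)}"
  show ?thesis
  proof
    have "(\<lambda>h. A * h) ` S \<subseteq> (\<lambda>c. \<Sum>i\<le>N. fps_of_poly (c i) * ?F i) ` ({..N} \<rightarrow>\<^sub>E {p. degree p \<le> D})"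
    proof
      fix g assume "g \<in> (\<lambda>h. A * h) ` S"
      then obtain c where c: "\<forall>i\<le>N. degree (c i) \<le> D" "g = (\<Sum>i\<le>N. fps_of_poly (c i) * ?F i)"
        unfolding S_def by auto
      show "g \<in> (\<lambda>c. \<Sum>i\<le>N. fps_of_poly (c i) * ?F i) ` ({..N} \<rightarrow>\<^sub>E {p. degree p \<le> D})"
        using c by (intro image_eqI[of _ _ "restrict c {..N}"]) auto
    qed
    then have "finite ((\<lambda>h. A * h) ` S)"
      by (rule finite_subset) (intro finite_imageI finite_PiE finite_degree_le finite_atMost)
    then show "finite S"
      by (rule finite_imageD) (use A in \<open>auto simp: inj_on_def\<close>)
  next
    have "(\<Sum>i\<le>N. fps_of_poly (if i = 0 then a 0 else 0) * ?F i) = A * f"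
      unfolding shift A_def by simp
    then show "f \<in> S"
      unfolding S_def using D by (auto intro!: exI[of _ "\<lambda>i. if i = 0 then a 0 else 0"])
  next
    show "\<forall>h\<in>S. \<forall>r<?q. fps_section ?q r h \<in> S"
    proof (intro ballI allI impI)
      fix h r assume h: "h \<in> S" and r: "r < ?q"
      obtain c where c: "\<forall>i\<le>N. degree (c i) \<le> D" "A * h = (\<Sum>i\<le>N. fps_of_poly (c i) * ?F i)"
        using h unfolding S_def by blast
      \<comment> \<open>These are the coefficients of \<open>h * A ^ ?q\<close> once the term in
        \<open>f\<close> is eliminated: one factor \<open>A\<close> comes with \<open>h\<close>, one
        pays for the elimination, and \<open>?q - 2\<close> more complete a \<open>?q\<close>-th
        power that passes through the section as \<open>A\<close>.\<close>
      define b where "b = (\<lambda>i. a 0 ^ (?q - 2) * (a 0 * c (Suc i) - c 0 * a (Suc i)))"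
      define c' where "c' = (\<lambda>i. if i < N then poly_section ?q r (b i) else 0)"
      have Af: "A * f = - (\<Sum>i<N. fps_of_poly (a (Suc i)) * ?F i ^ ?q)"
        using rel unfolding shift A_def by (simp add: eq_neg_iff_add_eq_0)
      \<comment> \<open>The relation trades \<open>f\<close> for \<open>q\<close>-th powers, on which taking sections lowers the exponent.\<close>
      have "A ^ ?q = A ^ (?q - 2) * (A * A)"
        using q2 by (metis le_add_diff_inverse2 power2_eq_square power_add)
      then have "h * A ^ ?q = A ^ (?q - 2) * (A * (A * h))" by (simp only: mult_ac)
      also have "A * (A * h) = fps_of_poly (c 0) * (A * f)
          + A * (\<Sum>i<N. fps_of_poly (c (Suc i)) * ?F i ^ ?q)"
        unfolding c(2) shift by (simp add: algebra_simps)
      also have "\<dots> = (\<Sum>i<N. (A * fps_of_poly (c (Suc i)) - fps_of_poly (c 0) * fps_of_poly (a (Suc i))) * ?F i ^ ?q)"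
        unfolding Af by (simp add: sum_distrib_left sum_subtractf left_diff_distrib mult.assoc)
      also have "A ^ (?q - 2) * \<dots> = (\<Sum>i<N. fps_of_poly (b i) * ?F i ^ ?q)"
        unfolding b_def A_def
        by (simp add: sum_distrib_left fps_of_poly_mult fps_of_poly_diff fps_of_poly_power mult.assoc)
      finally have *: "h * A ^ ?q = (\<Sum>i<N. fps_of_poly (b i) * ?F i ^ ?q)" .
      have "fps_section ?q r h * A = fps_section ?q r (h * A ^ ?q)"
        by (simp only: fps_section_mult_frobenius[OF r])
      also have "\<dots> = (\<Sum>i<N. fps_section ?q r (fps_of_poly (b i)) * ?F i)"
        by (simp only: * fps_section_sum fps_section_mult_frobenius[OF r])
      also have "\<dots> = (\<Sum>i\<le>N. fps_of_poly (c' i) * ?F i)"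
        unfolding lessThan_Suc_atMost[symmetric] sum.lessThan_Suc c'_def
        by (simp add: fps_of_poly_section)
      finally have "A * fps_section ?q r h = (\<Sum>i\<le>N. fps_of_poly (c' i) * ?F i)"
        by (simp add: mult.commute)
      \<comment> \<open>Each \<open>b i\<close> is a sum of products of \<open>?q\<close>
        polynomials of degree at most \<open>D\<close>; the section divides the degree bound
        \<open>?q * D\<close> by \<open>?q\<close>, so the same \<open>D\<close> works
        again.\<close>
      moreover have "degree (c' i) \<le> D" for i
      proof (cases "i < N")
        case True
        have "degree (a 0 * c (Suc i) - c 0 * a (Suc i)) \<le> D + D"
          using True c(1) D by (intro degree_diff_le order.trans[OF degree_mult_le] add_mono) auto
        moreover have "degree (a 0 ^ (?q - 2)) \<le> D * (?q - 2)"
          using D[of 0] by (intro order.trans[OF degree_power_le] mult_right_mono) auto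
        ultimately have "degree (b i) \<le> D * (?q - 2) + (D + D)"
          unfolding b_def by (intro order.trans[OF degree_mult_le] add_mono)
        also have "D * (?q - 2) + (D + D) = D * (?q - 2 + 2)" by (simp only: distrib_left)
        also have "\<dots> = ?q * D" using q2 by (simp only: le_add_diff_inverse2 mult.commute)
        finally show ?thesis
          using True unfolding c'_def by (simp add: degree_poly_section_le)
      qed (simp add: c'_def)
      ultimately show "fps_section ?q r h \<in> S" unfolding S_def by blast
    qed
  qed
qed

text \<open>A section at level \<open>l + 1\<close> is a single section, by the top
  base-\<open>q\<close> digit of \<open>r\<close>, of one at level \<open>l\<close>. Hence all of
  them stay in a finite set closed under single sections.\<close>

lemma algebraic_series_finite_kernel:
  fixes f :: "'p::prime_card mod_ring fps"
  assumes "algebraic_series f"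
  shows "finite {fps_section (CARD('p) ^ l) r f | l r. r < CARD('p) ^ l}"
proof -
  let ?q = "CARD('p)"
  obtain S where S: "finite S" "f \<in> S" "\<forall>h\<in>S. \<forall>r<?q. fps_section ?q r h \<in> S"
    using algebraic_series_finite_section_closed[OF assms] .
  have "fps_section (?q ^ l) r f \<in> S" if "r < ?q ^ l" for l r
    using that
  proof (induction l arbitrary: r)
    case 0
    moreover have "fps_section 1 0 f = f" by (rule fps_ext) simp
    ultimately show ?case using S(2) by simp
  next
    case (Suc l)
    have "fps_section (?q ^ Suc l) r f
        = fps_section ?q (r div ?q ^ l) (fps_section (?q ^ l) (r mod ?q ^ l) f)"
    proof (rule fps_ext)
      fix n
      have "?q ^ l * (?q * n + r div ?q ^ l) + r mod ?q ^ l
          = ?q ^ Suc l * n + (?q ^ l * (r div ?q ^ l) + r mod ?q ^ l)"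
        by (simp add: algebra_simps)
      also have "\<dots> = ?q ^ Suc l * n + r" by (simp only: mult_div_mod_eq)
      finally show "fps_nth (fps_section (?q ^ Suc l) r f) n
        = fps_nth (fps_section ?q (r div ?q ^ l) (fps_section (?q ^ l) (r mod ?q ^ l) f)) n"
        by simp
    qed
    moreover have "r div ?q ^ l < ?q" using Suc.prems by (intro less_mult_imp_div_less) simp
    ultimately show ?case using S(3) Suc.IH by simp
  qed
  then have "{fps_section (?q ^ l) r f | l r. r < ?q ^ l} \<subseteq> S" by blast
  then show ?thesis using S(1) by (rule finite_subset)
qed

lemma qfree_series_not_algebraic:
  assumes "m \<ge> 2"
  shows "\<not> algebraic_series (qfree_series m :: 'p::prime_card mod_ring fps)"
proof
  let ?q = "CARD('p)"
  let ?f = "qfree_series m :: 'p mod_ring fps"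
  \<comment> \<open>This decodes field coefficients into the values 0 and 1, which are distinct in
    the field, so finitely many sections give finitely many kernel sequences.\<close>
  let ?G = "\<lambda>g :: 'p mod_ring fps. \<lambda>n\<in>{1..}. if fps_nth g n = 0 then 0 else 1 :: nat"
  assume alg: "algebraic_series ?f"
  have "kernel_seqs ?q (qfree m) \<subseteq> ?G ` {fps_section (?q ^ l) r ?f | l r. r < ?q ^ l}"
  proof
    fix t assume "t \<in> kernel_seqs ?q (qfree m)"
    then obtain l r where r: "r < ?q ^ l" and t: "t = (\<lambda>n\<in>{1..}. qfree m (?q ^ l * n + r))"
      unfolding kernel_seqs_def by blast
    have "t = ?G (fps_section (?q ^ l) r ?f)"
    proof (unfold t, intro restrict_ext)
      fix n :: nat assume "n \<in> {1..}"
      \<comment> \<open>The index is positive, so the artificial constant coefficient 0 of the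
        series is never read.\<close>
      then have "1 \<le> ?q ^ l * n + r" by (simp add: Suc_le_eq)
      then show "qfree m (?q ^ l * n + r)
          = (if fps_nth (fps_section (?q ^ l) r ?f) n = 0 then 0 else 1)"
        by (simp add: qfree_series_def qfree_def)
    qed
    with r show "t \<in> ?G ` {fps_section (?q ^ l) r ?f | l r. r < ?q ^ l}" by blast
  qed
  then have "finite (kernel_seqs ?q (qfree m))"
    using algebraic_series_finite_kernel[OF alg] by (meson finite_imageI finite_subset)
  moreover have "qfree m ` {1..} \<subseteq> {0, 1}" by (auto simp: qfree_def)
  then have "finite (qfree m ` {1..})" by (rule finite_subset) simp
  ultimately have "automatic ?q (qfree m)" by (simp add: automatic_def)
  moreover have "?q \<ge> 2" using prime_ge_2_nat prime_card by blast
  ultimately show False using qfree_not_automatic[OF assms] by blast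
qed

section \<open>Reduction of integer power series modulo a prime\<close>

definition fps_map_of_int :: "int fps \<Rightarrow> 'a::comm_ring_1 fps" where
  "fps_map_of_int g = Abs_fps (\<lambda>n. of_int (fps_nth g n))"

interpretation fps_map_of_int_hom: comm_ring_hom "fps_map_of_int :: int fps \<Rightarrow> 'a::comm_ring_1 fps"
  by unfold_locales (auto simp: fps_map_of_int_def fps_eq_iff fps_mult_nth)

text \<open>
  Dividing an annihilating polynomial by its content ensures that it does not vanish modulo the
  characteristic.
\<close>

lemma algebraic_series_reduce_mod_prime:
  fixes f :: "int fps"
  assumes "algebraic_series f"
  shows "algebraic_series (fps_map_of_int f :: 'p::prime_card mod_ring fps)"
proof -
  let ?red = "map_poly of_int :: int poly \<Rightarrow> 'p mod_ring poly"
  obtain P where P: "P \<noteq> 0" "poly (map_poly fps_of_poly P) f = 0"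
    using assms unfolding algebraic_series_def by blast
  define Q where "Q = primitive_part P"
  have "poly (map_poly fps_of_poly (smult (content P) Q)) f = 0"
    unfolding Q_def content_times_primitive_part by (rule P(2))
  then have "fps_of_poly (content P) * poly (map_poly fps_of_poly Q) f = 0"
    by (simp only: fps_of_poly_hom.map_poly_hom_smult poly_smult)
  then have Q: "poly (map_poly fps_of_poly Q) f = 0" using P(1) by simp
  have "content Q = 1" unfolding Q_def using P(1) by simp
  have red: "fps_map_of_int (fps_of_poly a) = (fps_of_poly (?red a) :: 'p mod_ring fps)" for a
    by (rule fps_ext) (simp add: fps_map_of_int_def)
  have "map_poly fps_of_poly (map_poly ?red Q) = map_poly fps_map_of_int (map_poly fps_of_poly Q)"
    by (rule poly_eqI) (simp add: coeff_map_poly red)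
  then have "poly (map_poly fps_of_poly (map_poly ?red Q)) (fps_map_of_int f) = 0"
    by (simp only: fps_map_of_int_hom.poly_map_poly Q fps_map_of_int_hom.hom_zero)
  moreover have "map_poly ?red Q \<noteq> 0"
  proof
    assume 0: "map_poly ?red Q = 0"
    have "int CARD('p) dvd poly.coeff (poly.coeff Q i) j" for i j
    proof -
      have "of_int (poly.coeff (poly.coeff Q i) j) = poly.coeff (poly.coeff (map_poly ?red Q) i) j"
        by (simp add: coeff_map_poly)
      also have "\<dots> = (0 :: 'p mod_ring)" unfolding 0 by simp
      finally show ?thesis by (simp add: of_int_eq_0_iff_char_dvd)
    qed
    \<comment> \<open>The content of \<open>Q\<close> is itself an integer polynomial, so the prime
      enters first as a constant polynomial in the inner variable.\<close>
    then have "[:[:int CARD('p):]:] dvd Q" by (simp add: const_poly_dvd_iff)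
    then have "[:int CARD('p):] dvd 1" 
      unfolding const_poly_dvd_iff_dvd_content \<open>content Q = 1\<close> .
    then have "int CARD('p) dvd 1" by (simp only: is_unit_const_poly_iff)
    moreover have "CARD('p) \<ge> 2" using prime_ge_2_nat prime_card by blast
    ultimately show False by simp
  qed
  ultimately show ?thesis unfolding algebraic_series_def by blast
qed

theorem theorem2p15:
  fixes m :: nat
  assumes "m \<ge> 2"
  shows "(\<forall>k\<ge>2. \<not> automatic k (qfree m)) \<and>
    transcendental_series (qfree_series m :: 'p::prime_card mod_ring fps) \<and>
    transcendental_series (qfree_series m :: int fps)"
proof (intro conjI)
  show "\<forall>k\<ge>2. \<not> automatic k (qfree m)" using qfree_not_automatic[OF assms] by blast
  show "transcendental_series (qfree_series m :: 'p mod_ring fps)"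
    using qfree_series_not_algebraic[OF assms] not_transcendental_imp_algebraic_series by blast
  show "transcendental_series (qfree_series m :: int fps)"
  proof (rule ccontr)
    assume "\<not> transcendental_series (qfree_series m :: int fps)"
    \<comment> \<open>Reduction modulo a single prime suffices; the type \<open>'p\<close> of the
      finite-field claim supplies one.\<close>
    then have "algebraic_series (fps_map_of_int (qfree_series m) :: 'p mod_ring fps)"
      by (intro algebraic_series_reduce_mod_prime not_transcendental_imp_algebraic_series)
    moreover have "fps_map_of_int (qfree_series m) = (qfree_series m :: 'p mod_ring fps)"
      by (rule fps_ext) (simp add: fps_map_of_int_def qfree_series_def)
    ultimately have "algebraic_series (qfree_series m :: 'p mod_ring fps)" by (simp only:)
    then show False using qfree_series_not_algebraic[OF assms] by blast
  qed
qed

end
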